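(* Let $(S_x)_{x\in[0,1]}$ be a centered continuous Gaussian process with $S_0=0$, $\mathbb{E}[S_1^2]=1$, and covariance function $\Gamma(x,y)=\mathbb{E}[S_xS_y]$ that is continuous on $[0,1]^2$ and non-degenerate on $(0,1]^2$, and suppose that for some $\alpha_2>0$ $$(S_{rx})_{x\in[0,1]}\overset{d}{=}\big(r^{\alpha_2/2}S_x\big)_{x\in[0,1]},\quad r\in(0,1].$$ Suppose that $S$ satisfies a local functional law of the iterated logarithm (LIL) with a constant $\beta\in(0,\infty)$. Let $\gamma(x)=\Gamma(x,x)=x^{\alpha_2}$, $\kappa_x=\beta\sqrt{\gamma(x)\,\big|\log|\log x|\big|}$, and $$f(x)=\begin{cases}(1+S_x-\kappa_x)_+\wedge1,& x\in[0,1],\\ f_0(x),& x>1,\end{cases}$$ where the (random) function $f_0:(1,\infty)\to[0,1]$ is such that $\int_0^\infty f(x)\,\mathrm{d}x=1$ and $\int_0^\infty x f(x)\,\mathrm{d}x<\infty$. Then, almost surely, the following holds: $f\le1$, $\int_0^\infty xf(x)\,\mathrm{d}x<\infty$, and there exist a non-decreasing function $g:(0,\infty)\to(0,\infty)$ and a $\lambda_0>0$ such that $$\int_\mu^{\mu+1}f(\lambda x)\,\mathrm{d}x\le1-g\big(\lambda(\mu+1)\big)\quad\text{for all }\lambda\in(0,\lambda_0),\ \mu\in[0,1].$$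
   Context: Non-degenerate on $(0,1]^2$: for all distinct $x_1,\dots,x_n\in(0,1]$ the matrix $(\Gamma(x_i,x_j))_{i,j}$ is invertible. The values of $f$ at $x=0,1$ are immaterial. Let $H(\Gamma)$ be the reproducing kernel Hilbert space of $\Gamma$, i.e., the completion of the space of finite linear combinations of $\{\Gamma(x,\cdot)\}_{x\in[0,1]}$ under the norm induced by the inner product $\langle\Gamma(x,\cdot),\Gamma(y,\cdot)\rangle:=\Gamma(x,y)$; its elements satisfy $\phi(x)=\langle\phi,\Gamma(x,\cdot)\rangle$ and are continuous functions, so $H(\Gamma)\subset C([0,1])$ (with the supremum norm). Let $K=\{\phi\in H(\Gamma):\langle\phi,\phi\rangle\le1\}$, which is compact in $C([0,1])$. $S$ is said to satisfy a local functional LIL with constant $\beta\in(0,\infty)$ if, almost surely, the family $$\xi^r=(\xi^r_x)_{x\in[0,1]}:=\Big(\frac{S_{rx}}{\beta\sqrt{\gamma(r)\,|\log|\log r||}}\Big)_{x\in[0,1]},\quad r\in(0,1/3],$$ is relatively compact in $C([0,1])$ and the set of its limit points as $r\downarrow0$ is $K$. In particular, for every continuous functional $\mathcal I:C([0,1])\to\mathbb{R}$ one has $\limsup_{r\downarrow0}\mathcal I(\xi^r)=\sup_{\phi\in K}\mathcal I(\phi)$ almost surely. *)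

theory Defs
  imports
    "HOL-Probability.Probability"
    "HOL-Library.Poly_Mapping"
    "Jordan_Normal_Form.Matrix"
begin

text \<open>A Gaussian real random variable; variance zero (an almost surely constant variable) is allowed.\<close>

definition gaussian_rv :: "'w measure \<Rightarrow> ('w \<Rightarrow> real) \<Rightarrow> bool" where
  "gaussian_rv M X \<longleftrightarrow> X \<in> borel_measurable M \<and>
     ((\<exists>m \<sigma>. 0 < \<sigma> \<and> distributed M lborel X (normal_density m \<sigma>)) \<or>
      (\<exists>m. AE \<omega> in M. X \<omega> = m))"

definition gaussian_process :: "'w measure \<Rightarrow> real set \<Rightarrow> (real \<Rightarrow> 'w \<Rightarrow> real) \<Rightarrow> bool" where
  "gaussian_process M T S \<longleftrightarrow>
     (\<forall>F a. finite F \<longrightarrow> F \<subseteq> T \<longrightarrow> gaussian_rv M (\<lambda>\<omega>. \<Sum>x\<in>F. a x * S x \<omega>))"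

definition equal_in_law ::
    "'w measure \<Rightarrow> real set \<Rightarrow> (real \<Rightarrow> 'w \<Rightarrow> real) \<Rightarrow> (real \<Rightarrow> 'w \<Rightarrow> real) \<Rightarrow> bool" where
  "equal_in_law M T X Y \<longleftrightarrow>
     distr M (Pi\<^sub>M T (\<lambda>_. borel)) (\<lambda>\<omega>. \<lambda>x\<in>T. X x \<omega>) =
     distr M (Pi\<^sub>M T (\<lambda>_. borel)) (\<lambda>\<omega>. \<lambda>x\<in>T. Y x \<omega>)"

definition nondegenerate_kernel :: "real set \<Rightarrow> (real \<Rightarrow> real \<Rightarrow> real) \<Rightarrow> bool" where
  "nondegenerate_kernel T \<Gamma> \<longleftrightarrow>
     (\<forall>n (x :: nat \<Rightarrow> real). inj_on x {..<n} \<longrightarrow> x ` {..<n} \<subseteq> T \<longrightarrow>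
        invertible_mat (mat n n (\<lambda>(i, j). \<Gamma> (x i) (x j))))"

text \<open>
  The reproducing kernel Hilbert space of \<open>\<Gamma>\<close> on \<open>[0,1]\<close>.  A finitely supported function
  \<open>c :: real \<Rightarrow>\<^sub>0 real\<close> stands for the finite linear combination of the \<open>\<Gamma>(a,\<cdot>)\<close> with
  coefficients \<open>c(a)\<close>, and \<open>kernel_ip\<close> is the bilinear extension of
  \<open>\<langle>\<Gamma>(a,\<cdot>),\<Gamma>(b,\<cdot>)\<rangle> = \<Gamma>(a,b)\<close>.  The completion is realised as a space of functions: an abstract
  element of it, given by a Cauchy sequence \<open>c\<close> of finite combinations, is identified with the
  function \<open>\<phi>(x) = \<langle>\<phi>,\<Gamma>(x,\<cdot>)\<rangle> = lim\<^sub>n kernel_comb \<Gamma> (c n) x\<close>.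
  Functions on \<open>[0,1]\<close> are extensional, that is, undefined off \<open>[0,1]\<close>.
\<close>

definition kernel_comb :: "(real \<Rightarrow> real \<Rightarrow> real) \<Rightarrow> (real \<Rightarrow>\<^sub>0 real) \<Rightarrow> real \<Rightarrow> real" where
  "kernel_comb \<Gamma> c x = (\<Sum>a\<in>Poly_Mapping.keys c. Poly_Mapping.lookup c a * \<Gamma> a x)"

definition kernel_ip ::
    "(real \<Rightarrow> real \<Rightarrow> real) \<Rightarrow> (real \<Rightarrow>\<^sub>0 real) \<Rightarrow> (real \<Rightarrow>\<^sub>0 real) \<Rightarrow> real" where
  "kernel_ip \<Gamma> c d = (\<Sum>a\<in>Poly_Mapping.keys c. \<Sum>b\<in>Poly_Mapping.keys d.
     Poly_Mapping.lookup c a * Poly_Mapping.lookup d b * \<Gamma> a b)"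

definition rkhs_represents ::
    "(real \<Rightarrow> real \<Rightarrow> real) \<Rightarrow> (nat \<Rightarrow> real \<Rightarrow>\<^sub>0 real) \<Rightarrow> (real \<Rightarrow> real) \<Rightarrow> bool" where
  "rkhs_represents \<Gamma> c \<phi> \<longleftrightarrow>
     (\<forall>n. Poly_Mapping.keys (c n) \<subseteq> {0..1}) \<and>
     (\<forall>e>0. \<exists>N. \<forall>m\<ge>N. \<forall>n\<ge>N. sqrt (kernel_ip \<Gamma> (c m - c n) (c m - c n)) < e) \<and>
     (\<forall>x\<in>{0..1}. (\<lambda>n. kernel_comb \<Gamma> (c n) x) \<longlonglongrightarrow> \<phi> x)"

definition rkhs :: "(real \<Rightarrow> real \<Rightarrow> real) \<Rightarrow> (real \<Rightarrow> real) set" where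
  "rkhs \<Gamma> = {\<phi> \<in> extensional {0..1}. \<exists>c. rkhs_represents \<Gamma> c \<phi>}"

text \<open>For a positive semidefinite \<open>\<Gamma>\<close> the limit below exists and does not depend on the choice of
  the representing sequences.\<close>

definition rkhs_inner ::
    "(real \<Rightarrow> real \<Rightarrow> real) \<Rightarrow> (real \<Rightarrow> real) \<Rightarrow> (real \<Rightarrow> real) \<Rightarrow> real" where
  "rkhs_inner \<Gamma> \<phi> \<psi> =
     (THE l. \<forall>c d. rkhs_represents \<Gamma> c \<phi> \<longrightarrow> rkhs_represents \<Gamma> d \<psi> \<longrightarrow>
        (\<lambda>n. kernel_ip \<Gamma> (c n) (d n)) \<longlonglongrightarrow> l)"

definition rkhs_unit_ball :: "(real \<Rightarrow> real \<Rightarrow> real) \<Rightarrow> (real \<Rightarrow> real) set" where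
  "rkhs_unit_ball \<Gamma> = {\<phi> \<in> rkhs \<Gamma>. rkhs_inner \<Gamma> \<phi> \<phi> \<le> 1}"

text \<open>The space \<open>C([0,1])\<close> of (extensional) continuous functions with the supremum distance.\<close>

definition C01 :: "(real \<Rightarrow> real) metric" where
  "C01 = cfunspace (top_of_set {0..1}) euclidean_metric"

text \<open>At \<open>r = 1\<close> the convention \<open>ln 0 = 0\<close> gives the value 0 instead of \<open>\<infinity>\<close>.\<close>

definition lil_scale :: "real \<Rightarrow> (real \<Rightarrow> real) \<Rightarrow> real \<Rightarrow> real" where
  "lil_scale \<beta> \<gamma> r = \<beta> * sqrt (\<gamma> r * \<bar>ln \<bar>ln r\<bar>\<bar>)"

definition lil_rescaled ::
    "real \<Rightarrow> (real \<Rightarrow> real) \<Rightarrow> (real \<Rightarrow> real) \<Rightarrow> real \<Rightarrow> real \<Rightarrow> real" where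
  "lil_rescaled \<beta> \<gamma> s r = (\<lambda>x\<in>{0..1}. s (r * x) / lil_scale \<beta> \<gamma> r)"

definition relatively_compact_in :: "'a metric \<Rightarrow> 'a set \<Rightarrow> bool" where
  "relatively_compact_in m A \<longleftrightarrow>
     A \<subseteq> mspace m \<and> compactin (mtopology_of m) (mtopology_of m closure_of A)"

definition limit_points_at_0 :: "'a metric \<Rightarrow> real set \<Rightarrow> (real \<Rightarrow> 'a) \<Rightarrow> 'a set" where
  "limit_points_at_0 m R \<xi> = {\<phi>. \<exists>\<rho> :: nat \<Rightarrow> real.
     range \<rho> \<subseteq> R \<and> \<rho> \<longlonglongrightarrow> 0 \<and> limitin (mtopology_of m) (\<lambda>n. \<xi> (\<rho> n)) \<phi> sequentially}"

definition local_functional_LIL ::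
    "'w measure \<Rightarrow> (real \<Rightarrow> 'w \<Rightarrow> real) \<Rightarrow> (real \<Rightarrow> real \<Rightarrow> real) \<Rightarrow> real \<Rightarrow> bool" where
  "local_functional_LIL M S \<Gamma> \<beta> \<longleftrightarrow> 0 < \<beta> \<and>
     (AE \<omega> in M.
        let \<xi> = lil_rescaled \<beta> (\<lambda>x. \<Gamma> x x) (\<lambda>x. S x \<omega>) in
          relatively_compact_in C01 (\<xi> ` {0<..1/3}) \<and>
          limit_points_at_0 C01 {0<..1/3} \<xi> = rkhs_unit_ball \<Gamma>)"

end

theory Submission
  imports Defs "HOL-Real_Asymp.Real_Asymp"
begin

text \<open>
  Every \<open>\<phi>\<close> in the unit ball of the RKHS satisfies \<open>\<phi>(x)\<^sup>2 \<le> \<Gamma>(x,x)\<close>, with equality only if \<open>\<phi>\<close> is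
  a multiple of \<open>\<Gamma>(x,\<cdot>)\<close>; by non-degeneracy no \<open>\<phi>\<close> attains the bound, with positive sign, at both
  \<open>x = 1\<close> and \<open>x = 1/2\<close>.  If \<open>S \<ge> \<kappa>\<close> held at both \<open>r\<close> and \<open>r/2\<close> for arbitrarily small \<open>r\<close>, the
  rescaled paths along such \<open>r\<close> would by the LIL have a limit point in the unit ball attaining both
  bounds, because \<open>\<kappa>(r/2) / \<kappa>(r) \<rightarrow> 2 powr (- \<alpha>\<^sub>2/2)\<close>.  So almost surely, for every small \<open>r\<close>,
  \<open>f < 1\<close> at \<open>r\<close> or at \<open>r/2\<close>, and continuity of \<open>f\<close> turns this into a quantitative gap below 1 on
  \<open>[r/2, r]\<close>.
\<close>

section \<open>The unit ball of a reproducing kernel Hilbert space\<close>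

text \<open>Nothing is known of \<open>\<Gamma>\<close> off \<open>T \<times> T\<close>, hence the
  recurring condition that keys lie in \<open>T\<close>.\<close>

locale psd_kernel =
  fixes T :: "real set" and \<Gamma> :: "real \<Rightarrow> real \<Rightarrow> real"
  assumes sym: "x \<in> T \<Longrightarrow> y \<in> T \<Longrightarrow> \<Gamma> x y = \<Gamma> y x"
    and psd: "finite F \<Longrightarrow> F \<subseteq> T \<Longrightarrow> 0 \<le> (\<Sum>x\<in>F. \<Sum>y\<in>F. a x * a y * \<Gamma> x y)"

section \<open>Bilinear algebra of finite kernel combinations\<close>

lemma kernel_comb_superset:
  assumes "finite A" "Poly_Mapping.keys c \<subseteq> A"
  shows "kernel_comb \<Gamma> c x = (\<Sum>a\<in>A. Poly_Mapping.lookup c a * \<Gamma> a x)"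
  unfolding kernel_comb_def using assms
  by (intro sum.mono_neutral_left) (auto simp: in_keys_iff)

text \<open>Coefficients vanish off the keys. Enlarging the index sets puts combinations with
  different keys over one common set.\<close>

lemma kernel_ip_superset:
  assumes "finite A" "Poly_Mapping.keys c \<subseteq> A" "finite B" "Poly_Mapping.keys d \<subseteq> B"
  shows "kernel_ip \<Gamma> c d =
    (\<Sum>a\<in>A. \<Sum>b\<in>B. Poly_Mapping.lookup c a * Poly_Mapping.lookup d b * \<Gamma> a b)"
proof -
  have "kernel_ip \<Gamma> c d = (\<Sum>a\<in>Poly_Mapping.keys c. \<Sum>b\<in>B.
      Poly_Mapping.lookup c a * Poly_Mapping.lookup d b * \<Gamma> a b)"
    unfolding kernel_ip_def using assms
    by (intro sum.cong sum.mono_neutral_left) (auto simp: in_keys_iff)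
  also have "\<dots> = (\<Sum>a\<in>A. \<Sum>b\<in>B. Poly_Mapping.lookup c a * Poly_Mapping.lookup d b * \<Gamma> a b)"
    using assms by (intro sum.mono_neutral_left) (auto simp: in_keys_iff)
  finally show ?thesis .
qed

text \<open>The reproducing property in finite form: pairing with \<open>d\<close> evaluates the
  function of \<open>c\<close> at the keys of \<open>d\<close>. It turns pointwise convergence into
  convergence of inner products.\<close>

lemma kernel_ip_eq_sum_comb:
  "kernel_ip \<Gamma> c d = (\<Sum>b\<in>Poly_Mapping.keys d. Poly_Mapping.lookup d b * kernel_comb \<Gamma> c b)"
  unfolding kernel_ip_def kernel_comb_def
  by (subst sum.swap) (simp add: sum_distrib_left mult_ac)

lemma keys_diff_subset:
  fixes c d :: "'a \<Rightarrow>\<^sub>0 'b::ab_group_add"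
  shows "Poly_Mapping.keys (c - d) \<subseteq> Poly_Mapping.keys c \<union> Poly_Mapping.keys d"
  by (auto simp: in_keys_iff lookup_minus)

lemma keys_diff_subsetI:
  fixes c d :: "'a \<Rightarrow>\<^sub>0 'b::ab_group_add"
  shows "Poly_Mapping.keys c \<subseteq> T \<Longrightarrow> Poly_Mapping.keys d \<subseteq> T \<Longrightarrow> Poly_Mapping.keys (c - d) \<subseteq> T"
  using keys_diff_subset[of c d] by blast

lemma kernel_comb_diff: "kernel_comb \<Gamma> (c - d) x = kernel_comb \<Gamma> c x - kernel_comb \<Gamma> d x"
proof -
  let ?A = "Poly_Mapping.keys c \<union> Poly_Mapping.keys d"
  have "kernel_comb \<Gamma> e x = (\<Sum>a\<in>?A. Poly_Mapping.lookup e a * \<Gamma> a x)"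
    if "Poly_Mapping.keys e \<subseteq> ?A" for e
    using that by (intro kernel_comb_superset) auto
  from this[of c] this[of d] this[of "c - d"] show ?thesis
    using keys_diff_subset[of c d] by (simp add: lookup_minus algebra_simps sum_subtractf)
qed

lemma kernel_ip_diff_left: "kernel_ip \<Gamma> (c - d) e = kernel_ip \<Gamma> c e - kernel_ip \<Gamma> d e"
  by (simp add: kernel_ip_eq_sum_comb kernel_comb_diff algebra_simps sum_subtractf)

section \<open>Cauchy-Schwarz and the triangle inequality for finite combinations\<close>

context psd_kernel
begin

text \<open>In general only a seminorm, because \<open>\<Gamma>\<close> is merely positive
  semidefinite.\<close>

definition kernel_norm :: "(real \<Rightarrow>\<^sub>0 real) \<Rightarrow> real" where
  "kernel_norm c = sqrt (kernel_ip \<Gamma> c c)"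

lemma kernel_ip_commute:
  assumes "Poly_Mapping.keys c \<subseteq> T" "Poly_Mapping.keys d \<subseteq> T"
  shows "kernel_ip \<Gamma> c d = kernel_ip \<Gamma> d c"
proof -
  have "kernel_ip \<Gamma> c d = (\<Sum>a\<in>Poly_Mapping.keys c. \<Sum>b\<in>Poly_Mapping.keys d.
      Poly_Mapping.lookup d b * Poly_Mapping.lookup c a * \<Gamma> b a)"
    unfolding kernel_ip_def using assms by (intro sum.cong refl) (auto simp: sym subset_iff)
  then show ?thesis
    unfolding kernel_ip_def by (subst (asm) sum.swap)
qed

lemma kernel_ip_diff_right:
  assumes "Poly_Mapping.keys c \<subseteq> T" "Poly_Mapping.keys d \<subseteq> T" "Poly_Mapping.keys e \<subseteq> T"
  shows "kernel_ip \<Gamma> e (c - d) = kernel_ip \<Gamma> e c - kernel_ip \<Gamma> e d"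
proof -
  have "Poly_Mapping.keys (c - d) \<subseteq> T"
    using assms by (intro keys_diff_subsetI)
  then show ?thesis
    using assms kernel_ip_commute kernel_ip_diff_left by metis
qed

lemma kernel_ip_nonneg: "Poly_Mapping.keys c \<subseteq> T \<Longrightarrow> 0 \<le> kernel_ip \<Gamma> c c"
  unfolding kernel_ip_def by (rule psd) auto

lemma kernel_norm_nonneg: "Poly_Mapping.keys c \<subseteq> T \<Longrightarrow> 0 \<le> kernel_norm c"
  by (simp add: kernel_norm_def kernel_ip_nonneg)

lemma kernel_norm_power2: "Poly_Mapping.keys c \<subseteq> T \<Longrightarrow> (kernel_norm c)\<^sup>2 = kernel_ip \<Gamma> c c"
  by (simp add: kernel_norm_def kernel_ip_nonneg)

text \<open>The squared norm of \<open>c - t d\<close> is a quadratic in \<open>t\<close> that is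
  never negative. A vanishing leading coefficient has to be treated separately.\<close>

lemma kernel_ip_Cauchy_Schwarz:
  assumes c: "Poly_Mapping.keys c \<subseteq> T" and d: "Poly_Mapping.keys d \<subseteq> T"
  shows "\<bar>kernel_ip \<Gamma> c d\<bar> \<le> kernel_norm c * kernel_norm d"
proof -
  let ?F = "Poly_Mapping.keys c \<union> Poly_Mapping.keys d"
  let ?A = "kernel_ip \<Gamma> c c" and ?B = "kernel_ip \<Gamma> c d" and ?C = "kernel_ip \<Gamma> d d"
  have quad: "0 \<le> ?A - 2 * t * ?B + t\<^sup>2 * ?C" for t
  proof -
    let ?c = "Poly_Mapping.lookup c" and ?d = "Poly_Mapping.lookup d"
    have "0 \<le> (\<Sum>x\<in>?F. \<Sum>y\<in>?F. (?c x - t * ?d x) * (?c y - t * ?d y) * \<Gamma> x y)"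
      using c d by (intro psd) auto
    also have "\<dots> = (\<Sum>x\<in>?F. \<Sum>y\<in>?F. ?c x * ?c y * \<Gamma> x y) -
        t * (\<Sum>x\<in>?F. \<Sum>y\<in>?F. ?c x * ?d y * \<Gamma> x y) -
        t * (\<Sum>x\<in>?F. \<Sum>y\<in>?F. ?d x * ?c y * \<Gamma> x y) +
        t\<^sup>2 * (\<Sum>x\<in>?F. \<Sum>y\<in>?F. ?d x * ?d y * \<Gamma> x y)"
      by (simp add: sum_distrib_left sum_subtractf[symmetric] sum.distrib[symmetric]
          algebra_simps power2_eq_square)
    also have "\<dots> = ?A - t * ?B - t * kernel_ip \<Gamma> d c + t\<^sup>2 * ?C"
      by (subst (1 2 3 4) kernel_ip_superset[of ?F _ ?F]) auto
    finally show ?thesis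
      using kernel_ip_commute[OF c d] by simp
  qed
  have "?B\<^sup>2 \<le> ?A * ?C"
  proof (cases "?C = 0")
    case True
    have "?B = 0"
    proof (rule ccontr)
      assume "?B \<noteq> 0"
      then show False
        \<comment> \<open>With \<open>?C = 0\<close> the quadratic is linear in \<open>t\<close>,
          and this \<open>t\<close> gives it the value -1.\<close>
        using quad[of "(?A + 1) / (2 * ?B)"] True by (simp add: field_simps)
    qed
    then show ?thesis using True by simp
  next
    case False
    then have "?C > 0" using kernel_ip_nonneg[OF d] by simp
    then show ?thesis
      \<comment> \<open>The minimiser of the quadratic.\<close>
      using quad[of "?B / ?C"] by (simp add: field_simps power2_eq_square)
  qed
  then have "sqrt (?B\<^sup>2) \<le> sqrt (?A * ?C)"
    by (rule real_sqrt_le_mono)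
  then show ?thesis
    by (simp add: kernel_norm_def real_sqrt_mult)
qed

lemma kernel_norm_diff_commute:
  assumes "Poly_Mapping.keys c \<subseteq> T" "Poly_Mapping.keys d \<subseteq> T"
  shows "kernel_norm (c - d) = kernel_norm (d - c)"
proof -
  have "Poly_Mapping.keys (c - d) \<subseteq> T" "Poly_Mapping.keys (d - c) \<subseteq> T"
    using assms by (intro keys_diff_subsetI; simp)+
  then show ?thesis
    using assms by (simp add: kernel_norm_def kernel_ip_diff_left kernel_ip_diff_right)
qed

lemma kernel_norm_triangle:
  assumes c: "Poly_Mapping.keys c \<subseteq> T" and d: "Poly_Mapping.keys d \<subseteq> T"
  shows "kernel_norm c \<le> kernel_norm d + kernel_norm (c - d)"
proof (cases "kernel_norm c = 0")
  case True
  have "Poly_Mapping.keys (c - d) \<subseteq> T"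
    using assms by (intro keys_diff_subsetI)
  with True d show ?thesis by (simp add: kernel_norm_nonneg)
next
  case False
  then have pos: "kernel_norm c > 0"
    using kernel_norm_nonneg[OF c] by simp
  have cd: "Poly_Mapping.keys (c - d) \<subseteq> T"
    using assms by (intro keys_diff_subsetI)
  have "kernel_norm c * kernel_norm c = kernel_ip \<Gamma> c c"
    using kernel_norm_power2[OF c] by (simp add: power2_eq_square)
  also have "\<dots> = kernel_ip \<Gamma> d c + kernel_ip \<Gamma> (c - d) c"
    by (simp add: kernel_ip_diff_left)
  also have "\<dots> \<le> kernel_norm d * kernel_norm c + kernel_norm (c - d) * kernel_norm c"
    using kernel_ip_Cauchy_Schwarz[OF d c] kernel_ip_Cauchy_Schwarz[OF cd c] by linarith
  also have "\<dots> = (kernel_norm d + kernel_norm (c - d)) * kernel_norm c"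
    by (simp add: algebra_simps)
  finally show ?thesis using pos by simp
qed

end

section \<open>Limits of kernel combinations over [0,1] and the norm of the function they
  represent\<close>

locale unit_interval_kernel = psd_kernel "{0..1}" \<Gamma> for \<Gamma>
begin

text \<open>By the reverse triangle inequality the norms of a Cauchy sequence form a real Cauchy
  sequence.\<close>

lemma rkhs_represents_norm_convergent:
  assumes "rkhs_represents \<Gamma> c \<phi>"
  shows "convergent (\<lambda>n. kernel_norm (c n))"
proof -
  have keys: "\<And>n. Poly_Mapping.keys (c n) \<subseteq> {0..1}"
    and Cauchy: "\<And>e. e > 0 \<Longrightarrow> \<exists>N. \<forall>m\<ge>N. \<forall>n\<ge>N. kernel_norm (c m - c n) < e"
    using assms unfolding rkhs_represents_def kernel_norm_def by auto
  have le: "\<bar>kernel_norm (c m) - kernel_norm (c n)\<bar> \<le> kernel_norm (c m - c n)" for m n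
    using kernel_norm_triangle[OF keys[of m] keys[of n]]
      kernel_norm_triangle[OF keys[of n] keys[of m]]
      kernel_norm_diff_commute[OF keys[of m] keys[of n]] by linarith
  have "Cauchy (\<lambda>n. kernel_norm (c n))"
    unfolding Cauchy_def dist_real_def using Cauchy le by (meson le_less_trans)
  then show ?thesis by (simp add: Cauchy_convergent_iff)
qed

lemma rkhs_represents_tendsto_ip:
  assumes "rkhs_represents \<Gamma> c \<phi>" "Poly_Mapping.keys e \<subseteq> {0..1}"
  shows "(\<lambda>n. kernel_ip \<Gamma> (c n) e) \<longlonglongrightarrow>
    (\<Sum>b\<in>Poly_Mapping.keys e. Poly_Mapping.lookup e b * \<phi> b)"
  unfolding kernel_ip_eq_sum_comb
  using assms unfolding rkhs_represents_def by (intro tendsto_sum tendsto_mult_left) auto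

text \<open>For \<open>\<psi> = \<phi>\<close> this shows that two representing sequences of one
  function differ by a sequence representing 0.\<close>

lemma rkhs_represents_diff:
  assumes c: "rkhs_represents \<Gamma> c \<phi>" and d: "rkhs_represents \<Gamma> d \<psi>"
  shows "rkhs_represents \<Gamma> (\<lambda>n. c n - d n) (\<lambda>x. \<phi> x - \<psi> x)"
proof -
  have keys: "\<And>n. Poly_Mapping.keys (c n) \<subseteq> {0..1}" "\<And>n. Poly_Mapping.keys (d n) \<subseteq> {0..1}"
    using c d unfolding rkhs_represents_def by auto
  have keys_cd: "Poly_Mapping.keys (c m - d n) \<subseteq> {0..1}"
    "Poly_Mapping.keys (c m - c n) \<subseteq> {0..1}" "Poly_Mapping.keys (d m - d n) \<subseteq> {0..1}" for m n
    by (intro keys_diff_subsetI keys)+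
  have le: "kernel_norm ((c m - d m) - (c n - d n)) \<le> kernel_norm (c m - c n) + kernel_norm (d m - d n)"
    for m n
  proof -
    have "Poly_Mapping.keys ((c m - d m) - (c n - d n)) \<subseteq> {0..1}"
      by (intro keys_diff_subsetI keys_cd)
    from kernel_norm_triangle[OF this keys_cd(2)[of m n]]
    have "kernel_norm ((c m - d m) - (c n - d n)) \<le> kernel_norm (c m - c n) + kernel_norm (d n - d m)"
      by (simp add: algebra_simps)
    then show ?thesis
      using kernel_norm_diff_commute[OF keys(2)[of m] keys(2)[of n]] by simp
  qed
  have "\<exists>N. \<forall>m\<ge>N. \<forall>n\<ge>N. kernel_norm ((c m - d m) - (c n - d n)) < e" if "e > 0" for e
  proof -
    have "e / 2 > 0" using that by simp
    then obtain N1 N2 where "\<forall>m\<ge>N1. \<forall>n\<ge>N1. kernel_norm (c m - c n) < e / 2"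
      "\<forall>m\<ge>N2. \<forall>n\<ge>N2. kernel_norm (d m - d n) < e / 2"
      using c d unfolding rkhs_represents_def kernel_norm_def by metis
    then have "\<forall>m\<ge>max N1 N2. \<forall>n\<ge>max N1 N2. kernel_norm ((c m - d m) - (c n - d n)) < e"
      using le by (smt (verit) field_sum_of_halves max.bounded_iff)
    then show ?thesis ..
  qed
  then show ?thesis
    using c d keys_cd(1) unfolding rkhs_represents_def kernel_norm_def
    by (auto simp: kernel_comb_diff intro!: tendsto_diff)
qed

text \<open>This makes the identification of abstract elements with functions injective. Split the
  squared norm of \<open>e n\<close> into its pairings with \<open>e n - e N\<close> and with
  \<open>e N\<close>: the first is small by the Cauchy property and boundedness, the second tends to
  0 for fixed \<open>N\<close> by pointwise convergence.\<close>

lemma rkhs_represents_zero: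
  assumes "rkhs_represents \<Gamma> e (\<lambda>_. 0)"
  shows "(\<lambda>n. kernel_norm (e n)) \<longlonglongrightarrow> 0"
proof -
  have keys: "\<And>n. Poly_Mapping.keys (e n) \<subseteq> {0..1}"
    and Cauchy: "\<And>\<epsilon>. \<epsilon> > 0 \<Longrightarrow> \<exists>N. \<forall>m\<ge>N. \<forall>n\<ge>N. kernel_norm (e m - e n) < \<epsilon>"
    using assms unfolding rkhs_represents_def kernel_norm_def by auto
  have keys_diff: "Poly_Mapping.keys (e n - e m) \<subseteq> {0..1}" for m n
    by (intro keys_diff_subsetI keys)
  have "Bseq (\<lambda>n. kernel_norm (e n))"
    using rkhs_represents_norm_convergent[OF assms] by (rule convergent_imp_Bseq)
  then obtain B where B: "B > 0" "\<And>n. kernel_norm (e n) \<le> B"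
    unfolding Bseq_def by (auto simp: abs_le_iff)
  show ?thesis
  proof (rule tendstoI)
    fix \<epsilon> :: real assume "\<epsilon> > 0"
    \<comment> \<open>Multiplied by the norm bound \<open>B\<close>, this tolerance contributes half
      of the squared target.\<close>
    then have "\<epsilon>\<^sup>2 / (2 * B) > 0" using B(1) by simp
    from Cauchy[OF this] obtain N
      where N: "\<forall>m\<ge>N. \<forall>n\<ge>N. kernel_norm (e m - e n) < \<epsilon>\<^sup>2 / (2 * B)" ..
    have "(\<lambda>n. kernel_ip \<Gamma> (e n) (e N)) \<longlonglongrightarrow> 0"
      using rkhs_represents_tendsto_ip[OF assms keys, of N] by simp
    moreover have "\<epsilon>\<^sup>2 / 2 > 0" using \<open>\<epsilon> > 0\<close> by simp
    ultimately have "eventually (\<lambda>n. kernel_ip \<Gamma> (e n) (e N) < \<epsilon>\<^sup>2 / 2) sequentially"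
      by (rule order_tendstoD(2))
    then show "eventually (\<lambda>n. dist (kernel_norm (e n)) 0 < \<epsilon>) sequentially"
      using eventually_ge_at_top[of N]
    proof eventually_elim
      case (elim n)
      have "kernel_ip \<Gamma> (e n) (e n - e N) \<le> kernel_norm (e n) * kernel_norm (e n - e N)"
        using kernel_ip_Cauchy_Schwarz[OF keys[of n] keys_diff[of n N]] by simp
      also have "\<dots> \<le> B * (\<epsilon>\<^sup>2 / (2 * B))"
        using B N elim by (intro mult_mono) (auto simp: kernel_norm_nonneg keys keys_diff less_imp_le)
      finally have "kernel_ip \<Gamma> (e n) (e n - e N) \<le> \<epsilon>\<^sup>2 / 2" using B(1) by simp
      then have "(kernel_norm (e n))\<^sup>2 < \<epsilon>\<^sup>2"
        using elim by (simp add: kernel_norm_power2 keys kernel_ip_diff_right)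
      then show ?case
        using \<open>\<epsilon> > 0\<close> kernel_norm_nonneg[OF keys[of n]] by (simp add: power2_less_imp_less)
    qed
  qed
qed

text \<open>The definite description in \<open>rkhs_inner\<close> is justified here: every
  representing sequence is asymptotically norm-close to \<open>c\<close>, so all pairings share the
  limit computed along \<open>c\<close>.\<close>

lemma rkhs_inner_self_eq:
  assumes c: "rkhs_represents \<Gamma> c \<phi>" and L: "(\<lambda>n. kernel_norm (c n)) \<longlonglongrightarrow> L"
  shows "rkhs_inner \<Gamma> \<phi> \<phi> = L\<^sup>2"
  unfolding rkhs_inner_def
proof (rule the_equality)
  have close: "(\<lambda>n. kernel_norm (d n - c n)) \<longlonglongrightarrow> 0" if "rkhs_represents \<Gamma> d \<phi>" for d
    using rkhs_represents_diff[OF that c] by (intro rkhs_represents_zero) simp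
  show "\<forall>c' d'. rkhs_represents \<Gamma> c' \<phi> \<longrightarrow> rkhs_represents \<Gamma> d' \<phi> \<longrightarrow>
    (\<lambda>n. kernel_ip \<Gamma> (c' n) (d' n)) \<longlonglongrightarrow> L\<^sup>2"
  proof (intro allI impI)
    fix c' d' assume c': "rkhs_represents \<Gamma> c' \<phi>" and d': "rkhs_represents \<Gamma> d' \<phi>"
    have keys: "Poly_Mapping.keys (c n) \<subseteq> {0..1}" "Poly_Mapping.keys (c' n) \<subseteq> {0..1}"
      "Poly_Mapping.keys (d' n) \<subseteq> {0..1}" for n
      using c c' d' unfolding rkhs_represents_def by auto
    have keys_diff: "Poly_Mapping.keys (c' n - c n) \<subseteq> {0..1}"
      "Poly_Mapping.keys (d' n - c n) \<subseteq> {0..1}" for n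
      by (intro keys_diff_subsetI keys)+
    obtain D where D: "(\<lambda>n. kernel_norm (d' n)) \<longlonglongrightarrow> D"
      using rkhs_represents_norm_convergent[OF d'] unfolding convergent_def ..
    have lim: "(\<lambda>n. kernel_norm (c' n - c n) * kernel_norm (d' n) +
        kernel_norm (c n) * kernel_norm (d' n - c n)) \<longlonglongrightarrow> 0"
      using tendsto_add[OF tendsto_mult[OF close[OF c'] D] tendsto_mult[OF L close[OF d']]] by simp
    \<comment> \<open>Replace one argument at a time and apply Cauchy-Schwarz to each error.\<close>
    have "\<bar>kernel_ip \<Gamma> (c' n) (d' n) - kernel_ip \<Gamma> (c n) (c n)\<bar>
      \<le> kernel_norm (c' n - c n) * kernel_norm (d' n) + kernel_norm (c n) * kernel_norm (d' n - c n)" for n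
    proof -
      have "kernel_ip \<Gamma> (c' n) (d' n) - kernel_ip \<Gamma> (c n) (c n) =
        kernel_ip \<Gamma> (c' n - c n) (d' n) + kernel_ip \<Gamma> (c n) (d' n - c n)"
        by (simp add: kernel_ip_diff_left kernel_ip_diff_right keys)
      then show ?thesis
        using kernel_ip_Cauchy_Schwarz[OF keys_diff(1)[of n] keys(3)[of n]]
          kernel_ip_Cauchy_Schwarz[OF keys(1)[of n] keys_diff(2)[of n]] by linarith
    qed
    then have "(\<lambda>n. kernel_ip \<Gamma> (c' n) (d' n) - kernel_ip \<Gamma> (c n) (c n)) \<longlonglongrightarrow> 0"
      by (intro Lim_null_comparison[OF _ lim]) auto
    moreover have "(\<lambda>n. kernel_ip \<Gamma> (c n) (c n)) \<longlonglongrightarrow> L\<^sup>2"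
      using tendsto_power[OF L, of 2] by (simp add: kernel_norm_power2 keys)
    ultimately have "(\<lambda>n. kernel_ip \<Gamma> (c' n) (d' n) - kernel_ip \<Gamma> (c n) (c n) + kernel_ip \<Gamma> (c n) (c n))
      \<longlonglongrightarrow> 0 + L\<^sup>2"
      by (rule tendsto_add)
    then show "(\<lambda>n. kernel_ip \<Gamma> (c' n) (d' n)) \<longlonglongrightarrow> L\<^sup>2" by simp
  qed
  then show "l = L\<^sup>2" if "\<forall>c d. rkhs_represents \<Gamma> c \<phi> \<longrightarrow> rkhs_represents \<Gamma> d \<phi> \<longrightarrow>
    (\<lambda>n. kernel_ip \<Gamma> (c n) (d n)) \<longlonglongrightarrow> l" for l
    using that c LIMSEQ_unique by blast
qed

text \<open>The sum is the inner product of \<phi> with the combination \<open>e\<close>;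
  Cauchy-Schwarz along a representing sequence passes to the limit, where the norm of \<phi> is at
  most 1.\<close>

lemma rkhs_unit_ball_functional_le:
  assumes "\<phi> \<in> rkhs_unit_ball \<Gamma>" and e: "Poly_Mapping.keys e \<subseteq> {0..1}"
  shows "\<bar>\<Sum>b\<in>Poly_Mapping.keys e. Poly_Mapping.lookup e b * \<phi> b\<bar> \<le> kernel_norm e"
proof -
  obtain c where c: "rkhs_represents \<Gamma> c \<phi>" and le: "rkhs_inner \<Gamma> \<phi> \<phi> \<le> 1"
    using assms unfolding rkhs_unit_ball_def rkhs_def by auto
  then have keys: "\<And>n. Poly_Mapping.keys (c n) \<subseteq> {0..1}"
    unfolding rkhs_represents_def by auto
  obtain L where L: "(\<lambda>n. kernel_norm (c n)) \<longlonglongrightarrow> L"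
    using rkhs_represents_norm_convergent[OF c] unfolding convergent_def ..
  have "L \<le> 1"
    using rkhs_inner_self_eq[OF c L] le power2_le_imp_le[of L 1] by simp
  have "\<bar>\<Sum>b\<in>Poly_Mapping.keys e. Poly_Mapping.lookup e b * \<phi> b\<bar> \<le> L * kernel_norm e"
  proof (rule LIMSEQ_le)
    show "(\<lambda>n. \<bar>kernel_ip \<Gamma> (c n) e\<bar>) \<longlonglongrightarrow> \<bar>\<Sum>b\<in>Poly_Mapping.keys e. Poly_Mapping.lookup e b * \<phi> b\<bar>"
      by (intro tendsto_rabs rkhs_represents_tendsto_ip c e)
    show "(\<lambda>n. kernel_norm (c n) * kernel_norm e) \<longlonglongrightarrow> L * kernel_norm e"
      by (intro tendsto_mult_right L)
  qed (use kernel_ip_Cauchy_Schwarz[OF keys e] in auto)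
  also have "\<dots> \<le> kernel_norm e"
    using mult_right_mono[OF \<open>L \<le> 1\<close> kernel_norm_nonneg[OF e]] by simp
  finally show ?thesis .
qed

text \<open>The preceding bound, squared, for the combination with coefficients \<open>a\<close> at
  \<open>x\<close> and \<open>b\<close> at \<open>y\<close>. Either coefficient may vanish, so its
  keys are only known to lie in \<open>{x, y}\<close>.\<close>

lemma rkhs_unit_ball_two_point:
  assumes \<phi>: "\<phi> \<in> rkhs_unit_ball \<Gamma>" and xy: "x \<in> {0..1}" "y \<in> {0..1}" "x \<noteq> y"
  shows "(a * \<phi> x + b * \<phi> y)\<^sup>2 \<le> a\<^sup>2 * \<Gamma> x x + 2 * a * b * \<Gamma> x y + b\<^sup>2 * \<Gamma> y y"
proof -
  define e where "e = Poly_Mapping.single x a + Poly_Mapping.single y b"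
  have lookup: "Poly_Mapping.lookup e x = a" "Poly_Mapping.lookup e y = b"
    using xy by (auto simp: e_def lookup_add lookup_single)
  have sub: "Poly_Mapping.keys e \<subseteq> {x, y}"
    by (auto simp: e_def in_keys_iff lookup_add lookup_single when_def split: if_splits)
  then have keys: "Poly_Mapping.keys e \<subseteq> {0..1}" using xy by auto
  have "(\<Sum>z\<in>Poly_Mapping.keys e. Poly_Mapping.lookup e z * \<phi> z) = (\<Sum>z\<in>{x, y}. Poly_Mapping.lookup e z * \<phi> z)"
    using sub by (intro sum.mono_neutral_left) (auto simp: in_keys_iff)
  then have "\<bar>a * \<phi> x + b * \<phi> y\<bar> \<le> kernel_norm e"
    using rkhs_unit_ball_functional_le[OF \<phi> keys] xy by (simp add: lookup)
  then have "\<bar>a * \<phi> x + b * \<phi> y\<bar>\<^sup>2 \<le> kernel_ip \<Gamma> e e"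
    using power_mono[of "\<bar>a * \<phi> x + b * \<phi> y\<bar>" "kernel_norm e" 2] kernel_norm_power2[OF keys] by simp
  also have "kernel_ip \<Gamma> e e = a\<^sup>2 * \<Gamma> x x + 2 * a * b * \<Gamma> x y + b\<^sup>2 * \<Gamma> y y"
    using xy sym[of x y] sub
    by (subst kernel_ip_superset[of "{x, y}" _ "{x, y}"]) (auto simp: lookup power2_eq_square algebra_simps)
  finally show ?thesis by simp
qed

end

section \<open>Covariance kernels of Gaussian processes\<close>

lemma gaussian_rv_integrable_square:
  assumes "prob_space M" and X: "gaussian_rv M X"
  shows "integrable M (\<lambda>\<omega>. (X \<omega>)\<^sup>2)"
proof -
  interpret prob_space M by fact
  have meas: "X \<in> borel_measurable M" using X unfolding gaussian_rv_def by simp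
  consider m \<sigma> where "0 < \<sigma>" "distributed M lborel X (normal_density m \<sigma>)"
    | m where "AE \<omega> in M. X \<omega> = m"
    using X unfolding gaussian_rv_def by blast
  then show ?thesis
  proof cases
    case 1
    \<comment> \<open>The square of \<open>x\<close> is expanded about the mean \<open>m\<close> to
      use the integrability of centered moments.\<close>
    have "integrable lborel (\<lambda>x. normal_density m \<sigma> x * (x - m)\<^sup>2 +
        (2 * m) * (normal_density m \<sigma> x * (x - m)^1) + m\<^sup>2 * normal_density m \<sigma> x)"
      using 1(1) by (intro Bochner_Integration.integrable_add integrable_mult_right
          integrable_normal_moment integrable_normal_density) auto
    also have "(\<lambda>x. normal_density m \<sigma> x * (x - m)\<^sup>2 +
        (2 * m) * (normal_density m \<sigma> x * (x - m)^1) + m\<^sup>2 * normal_density m \<sigma> x) =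
        (\<lambda>x. normal_density m \<sigma> x * x\<^sup>2)"
      by (simp add: fun_eq_iff power2_eq_square algebra_simps)
    finally show ?thesis
      using distributed_integrable[OF 1(2), of "\<lambda>x. x\<^sup>2"] by simp
  next
    case 2
    have "integrable M (\<lambda>\<omega>. m\<^sup>2)" by simp
    then show ?thesis
      by (rule integrable_cong_AE_imp) (use meas 2 in auto)
  qed
qed

lemma gaussian_process_rv:
  assumes "gaussian_process M T S" "x \<in> T"
  shows "gaussian_rv M (S x)"
proof -
  have "gaussian_rv M (\<lambda>\<omega>. \<Sum>y\<in>{x}. 1 * S y \<omega>)"
    using assms unfolding gaussian_process_def
    by (elim allE[of _ "{x}"] allE[of _ "\<lambda>_. 1"]) auto
  then show ?thesis by simp
qed

lemma integrable_product_of_squares: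
  fixes X Y :: "'a \<Rightarrow> real"
  assumes [measurable]: "X \<in> borel_measurable M" "Y \<in> borel_measurable M"
    and "integrable M (\<lambda>\<omega>. (X \<omega>)\<^sup>2)" "integrable M (\<lambda>\<omega>. (Y \<omega>)\<^sup>2)"
  shows "integrable M (\<lambda>\<omega>. X \<omega> * Y \<omega>)"
proof (rule Bochner_Integration.integrable_bound)
  show "integrable M (\<lambda>\<omega>. (X \<omega>)\<^sup>2 + (Y \<omega>)\<^sup>2)"
    using assms by simp
  have "\<bar>x * y\<bar> \<le> x\<^sup>2 + y\<^sup>2" for x y :: real
    using sum_squares_bound[of "\<bar>x\<bar>" "\<bar>y\<bar>"] abs_ge_zero[of "x * y"]
    unfolding abs_mult power2_abs by linarith
  then show "AE \<omega> in M. norm (X \<omega> * Y \<omega>) \<le> norm ((X \<omega>)\<^sup>2 + (Y \<omega>)\<^sup>2)"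
    by simp
qed simp

text \<open>The quadratic form is the second moment of a linear combination of the process. Square
  integrability allows expectation and sums to be interchanged.\<close>

lemma covariance_psd_kernel:
  assumes meas: "\<And>x. x \<in> T \<Longrightarrow> S x \<in> borel_measurable M"
    and sq: "\<And>x. x \<in> T \<Longrightarrow> integrable M (\<lambda>\<omega>. (S x \<omega>)\<^sup>2)"
    and cov: "\<And>x y. x \<in> T \<Longrightarrow> y \<in> T \<Longrightarrow> \<Gamma> x y = (\<integral>\<omega>. S x \<omega> * S y \<omega> \<partial>M)"
  shows "psd_kernel T \<Gamma>"
proof
  fix x y assume "x \<in> T" "y \<in> T"
  then show "\<Gamma> x y = \<Gamma> y x" by (simp add: cov mult.commute)
next
  fix F and a :: "real \<Rightarrow> real" assume F: "finite F" "F \<subseteq> T"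
  have int: "integrable M (\<lambda>\<omega>. S x \<omega> * S y \<omega>)" if "x \<in> F" "y \<in> F" for x y
    using that F meas sq by (intro integrable_product_of_squares) auto
  have "0 \<le> (\<integral>\<omega>. (\<Sum>x\<in>F. a x * S x \<omega>)\<^sup>2 \<partial>M)" by simp
  also have "\<dots> = (\<integral>\<omega>. (\<Sum>x\<in>F. \<Sum>y\<in>F. a x * a y * (S x \<omega> * S y \<omega>)) \<partial>M)"
    by (simp add: power2_eq_square sum_product mult_ac)
  also have "\<dots> = (\<Sum>x\<in>F. \<Sum>y\<in>F. \<integral>\<omega>. a x * a y * (S x \<omega> * S y \<omega>) \<partial>M)"
    using int by (simp add: Bochner_Integration.integral_sum)
  also have "\<dots> = (\<Sum>x\<in>F. \<Sum>y\<in>F. a x * a y * \<Gamma> x y)"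
    using F by (intro sum.cong refl) (auto simp: cov subset_iff)
  finally show "0 \<le> (\<Sum>x\<in>F. \<Sum>y\<in>F. a x * a y * \<Gamma> x y)" .
qed

lemma equal_in_law_second_moment:
  fixes X Y :: "real \<Rightarrow> 'w \<Rightarrow> real"
  assumes "equal_in_law M T X Y" and t: "t \<in> T"
    and X: "\<And>x. x \<in> T \<Longrightarrow> X x \<in> borel_measurable M"
    and Y: "\<And>x. x \<in> T \<Longrightarrow> Y x \<in> borel_measurable M"
  shows "(\<integral>\<omega>. (X t \<omega>)\<^sup>2 \<partial>M) = (\<integral>\<omega>. (Y t \<omega>)\<^sup>2 \<partial>M)"
proof -
  let ?P = "Pi\<^sub>M T (\<lambda>_. borel :: real measure)"
  have sq: "(\<lambda>w. (w t)\<^sup>2) \<in> borel_measurable ?P"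
    using t by measurable
  have *: "(\<integral>w. (w t)\<^sup>2 \<partial>distr M ?P (\<lambda>\<omega>. \<lambda>x\<in>T. Z x \<omega>)) = (\<integral>\<omega>. (Z t \<omega>)\<^sup>2 \<partial>M)"
    if "\<And>x. x \<in> T \<Longrightarrow> Z x \<in> borel_measurable M" for Z :: "real \<Rightarrow> 'w \<Rightarrow> real"
    using that t by (subst integral_distr[OF _ sq]) (auto intro!: measurable_restrict)
  show ?thesis
    using *[of X] *[of Y] X Y assms(1) unfolding equal_in_law_def by simp
qed

text \<open>Scaling compared at the single time 1. With unit variance there, it gives the diagonal
  of \<open>\<Gamma>\<close> as a pure power.\<close>

lemma self_similar_second_moment:
  fixes S :: "real \<Rightarrow> 'w \<Rightarrow> real"
  assumes "equal_in_law M {0..1} (\<lambda>x \<omega>. S (r * x) \<omega>) (\<lambda>x \<omega>. r powr (\<alpha> / 2) * S x \<omega>)"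
    and "r \<in> {0<..1}" and meas: "\<And>x. x \<in> {0..1} \<Longrightarrow> S x \<in> borel_measurable M"
  shows "(\<integral>\<omega>. (S r \<omega>)\<^sup>2 \<partial>M) = r powr \<alpha> * (\<integral>\<omega>. (S 1 \<omega>)\<^sup>2 \<partial>M)"
proof -
  have "(\<integral>\<omega>. (S (r * 1) \<omega>)\<^sup>2 \<partial>M) = (\<integral>\<omega>. (r powr (\<alpha> / 2) * S 1 \<omega>)\<^sup>2 \<partial>M)"
    using assms(2)
    by (intro equal_in_law_second_moment[OF assms(1)] meas borel_measurable_times) (auto simp: mult_le_one)
  also have "\<dots> = r powr \<alpha> * (\<integral>\<omega>. (S 1 \<omega>)\<^sup>2 \<partial>M)"
    by (simp add: power_mult_distrib power2_eq_square[of "r powr _"] powr_add[symmetric])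
  finally show ?thesis by simp
qed

text \<open>The determinant of the 2 by 2 kernel matrix times that of its inverse is 1; this is
  checked entry by entry.\<close>

lemma nondegenerate_kernel_two_points:
  assumes "nondegenerate_kernel T \<Gamma>" "x \<in> T" "y \<in> T" "x \<noteq> y"
  shows "\<Gamma> x x * \<Gamma> y y \<noteq> \<Gamma> x y * \<Gamma> y x"
proof -
  define p where "p = (\<lambda>i::nat. if i = 0 then x else y)"
  define A where "A = mat 2 2 (\<lambda>(i, j). \<Gamma> (p i) (p j))"
  have "inj_on p {..<2}" "p ` {..<2} \<subseteq> T"
    using assms by (auto simp: p_def inj_on_def)
  then have "invertible_mat A"
    using assms(1) unfolding nondegenerate_kernel_def A_def by blast
  then obtain B where B: "A * B = 1\<^sub>m 2" "B * A = 1\<^sub>m (dim_row B)"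
    unfolding invertible_mat_def inverts_mat_def by (auto simp: A_def)
  \<comment> \<open>The inverse comes without a stated size; comparing column counts in the two
    identities determines it.\<close>
  have dims: "dim_row B = 2" "dim_col B = 2"
    using arg_cong[OF B(1), of dim_col] arg_cong[OF B(2), of dim_col] by (auto simp: A_def)
  have entry: "\<Gamma> (p i) x * B $$ (0, j) + \<Gamma> (p i) y * B $$ (1, j) = (if i = j then 1 else 0)"
    if "i < 2" "j < 2" for i j
  proof -
    have "(A * B) $$ (i, j) = (\<Sum>k\<in>{0..<2}. \<Gamma> (p i) (p k) * B $$ (k, j))"
      using that dims by (simp add: A_def scalar_prod_def)
    also have "\<dots> = \<Gamma> (p i) x * B $$ (0, j) + \<Gamma> (p i) y * B $$ (1, j)"
      by (simp add: numeral_2_eq_2 p_def)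
    finally show ?thesis using that B(1) by simp
  qed
  have "\<Gamma> x x * B $$ (0, 0) + \<Gamma> x y * B $$ (1, 0) = 1"
    "\<Gamma> x x * B $$ (0, 1) + \<Gamma> x y * B $$ (1, 1) = 0"
    "\<Gamma> y x * B $$ (0, 0) + \<Gamma> y y * B $$ (1, 0) = 0"
    "\<Gamma> y x * B $$ (0, 1) + \<Gamma> y y * B $$ (1, 1) = 1"
    using entry[of 0 0] entry[of 0 1] entry[of 1 0] entry[of 1 1] by (auto simp: p_def)
  moreover have "(\<Gamma> x x * \<Gamma> y y - \<Gamma> x y * \<Gamma> y x) *
      (B $$ (0, 0) * B $$ (1, 1) - B $$ (0, 1) * B $$ (1, 0)) =
      (\<Gamma> x x * B $$ (0, 0) + \<Gamma> x y * B $$ (1, 0)) * (\<Gamma> y x * B $$ (0, 1) + \<Gamma> y y * B $$ (1, 1)) -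
      (\<Gamma> x x * B $$ (0, 1) + \<Gamma> x y * B $$ (1, 1)) * (\<Gamma> y x * B $$ (0, 0) + \<Gamma> y y * B $$ (1, 0))"
    by (simp add: algebra_simps)
  ultimately have "(\<Gamma> x x * \<Gamma> y y - \<Gamma> x y * \<Gamma> y x) *
      (B $$ (0, 0) * B $$ (1, 1) - B $$ (0, 1) * B $$ (1, 0)) = 1"
    by simp
  then show ?thesis by auto
qed

section \<open>Functions staying below 1\<close>

text \<open>
  For \<open>\<mu> \<le> 1\<close> the interval \<open>[\<mu>, \<mu> + 1]\<close> contains \<open>[(\<mu> + 1) / 2, \<mu> + 1]\<close>, so with
  \<open>r = l (\<mu> + 1)\<close> the mass of \<open>1 - F\<close> is at least \<open>G r = \<integral>\<^bsub>1/2\<^esub>\<^bsup>1\<^esup> (1 - F (r y)) dy\<close>, a positive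
  continuous function of \<open>r\<close>; its running infimum from the right is \<open>g\<close>.
\<close>

lemma continuous_gap_lower_bound:
  fixes F :: "real \<Rightarrow> real"
  assumes r0: "r0 > 0" and cont: "continuous_on {0<..r0} F"
    and range: "\<And>x. x \<ge> 0 \<Longrightarrow> F x \<in> {0..1}"
    and gap: "\<And>r. r \<in> {0<..r0} \<Longrightarrow> F r < 1 \<or> F (r / 2) < 1"
  shows "\<exists>g :: real \<Rightarrow> real. \<exists>l\<^sub>0>0. (\<forall>x>0. g x > 0) \<and> mono_on {0<..} g \<and>
    (\<forall>l\<in>{0<..<l\<^sub>0}. \<forall>\<mu>\<in>{0..1}.
      set_lebesgue_integral lebesgue {\<mu>..\<mu> + 1} (\<lambda>x. F (l * x)) \<le> 1 - g (l * (\<mu> + 1)))"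
proof -
  define G where "G r = integral {1/2..1} (\<lambda>y. 1 - F (r * y))" for r
  \<comment> \<open>The \<open>min\<close> keeps the interval nonempty beyond \<open>r0\<close>,
    where \<open>g\<close> is constantly \<open>G r0\<close>.\<close>
  define g where "g r = Inf (G ` {min r r0..r0})" for r
  have in_dom: "r * y \<in> {0<..r0}" if "r \<in> {0<..r0}" "y \<in> {1/2..1}" for r y
  proof -
    have "r * y \<le> r0 * 1" using that r0 by (intro mult_mono) auto
    then show ?thesis using that by auto
  qed
  have "continuous_on ({0<..r0} \<times> cbox (1/2) 1) (\<lambda>(r, y). 1 - F (r * y))"
    unfolding split_beta
    by (intro continuous_intros continuous_on_compose2[OF cont]) (use in_dom in \<open>auto simp: split_beta\<close>)
  from integral_continuous_on_param[OF this]
  have contG: "continuous_on {0<..r0} G" by (simp add: G_def [abs_def])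
  have posG: "G r > 0" if r: "r \<in> {0<..r0}" for r
  proof -
    let ?h = "\<lambda>y. 1 - F (r * y)"
    have c: "continuous_on {1/2..1} ?h"
      by (intro continuous_intros continuous_on_compose2[OF cont]) (use in_dom[OF r] in auto)
    have nn: "?h y \<ge> 0" if "y \<in> {1/2..1}" for y
      using range[of "r * y"] in_dom[OF r that] by auto
    \<comment> \<open>The two endpoints correspond to \<open>r\<close> and \<open>r / 2\<close>, and
      \<open>gap\<close> excludes that \<open>F\<close> equals 1 at both.\<close>
    have "\<not> (\<forall>y\<in>{1/2..1}. ?h y = 0)"
    proof
      assume *: "\<forall>y\<in>{1/2..1}. ?h y = 0"
      have "?h 1 = 0" "?h (1/2) = 0" using bspec[OF *, of 1] bspec[OF *, of "1/2"] by simp_all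
      then show False using gap[OF r] by simp
    qed
    then have "G r \<noteq> 0" unfolding G_def using integral_eq_0_iff[OF c _ nn] by simp
    moreover have "G r \<ge> 0" unfolding G_def
      using c nn by (intro integral_nonneg integrable_continuous_real) auto
    ultimately show ?thesis by simp
  qed
  have sub: "{min r r0..r0} \<subseteq> {0<..r0}" if "r > 0" for r
    using that r0 by auto
  \<comment> \<open>Attainment on a compact interval makes the infimum strictly positive, as
    \<open>G\<close> itself is.\<close>
  have attained: "\<exists>x\<in>{min r r0..r0}. \<forall>y\<in>{min r r0..r0}. G x \<le> G y" if "r > 0" for r
    by (rule continuous_attains_inf) (use continuous_on_subset[OF contG sub[OF that]] in auto)
  have bdd: "bdd_below (G ` {min r r0..r0})" if "r > 0" for r
    using attained[OF that] by (auto intro: bdd_belowI2)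
  have "g r > 0" if r: "r > 0" for r
  proof -
    obtain x where x: "x \<in> {min r r0..r0}" "\<forall>y\<in>{min r r0..r0}. G x \<le> G y"
      using attained[OF r] by blast
    then have "g r = G x" unfolding g_def by (intro cInf_eq_minimum) auto
    then show ?thesis using posG sub[OF r] x by auto
  qed
  moreover have "mono_on {0<..} g"
  proof (rule mono_onI)
    fix r s :: real assume "r \<in> {0<..}" "s \<in> {0<..}" "r \<le> s"
    then show "g r \<le> g s"
      unfolding g_def by (intro cInf_superset_mono bdd image_mono) auto
  qed
  \<comment> \<open>Since \<mu> + 1 is at most 2, taking \<open>l\<close> below
    \<open>r0 / 2\<close> keeps all arguments of \<open>F\<close> at most \<open>r0\<close>.\<close>
  moreover have "set_lebesgue_integral lebesgue {\<mu>..\<mu> + 1} (\<lambda>x. F (l * x)) \<le> 1 - g (l * (\<mu> + 1))"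
    if l: "l \<in> {0<..<r0 / 2}" and \<mu>: "\<mu> \<in> {0..1}" for l \<mu>
  proof -
    define b where "b = \<mu> + 1"
    have b: "1 \<le> b" "b \<le> 2" "\<mu> \<le> b / 2" using \<mu> by (auto simp: b_def)
    have "l * b \<le> l * 2" using l b by (intro mult_left_mono) auto
    also have "\<dots> \<le> r0" using l by simp
    finally have r: "l * b \<in> {0<..r0}" using l b by simp
    let ?h = "\<lambda>x. 1 - F (l * x)"
    have dom: "l * x \<in> {0<..r0}" if "x \<in> {b / 2..b}" for x
      using in_dom[OF r, of "x / b"] that b by (auto simp: field_simps)
    have c: "continuous_on {b / 2..b} ?h"
      by (intro continuous_intros continuous_on_compose2[OF cont]) (use dom in auto)
    then have si: "set_integrable lebesgue {b / 2..b} ?h"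
      by (intro absolutely_integrable_continuous_real)
    have I: "(?h has_integral integral {b / 2..b} ?h) (cbox (b / 2) b)"
      using integrable_continuous_real[OF c] by (simp add: integrable_integral)
    have "(\<lambda>x. (1 / b) *\<^sub>R x + - ((1 / b) *\<^sub>R 0)) ` cbox (b / 2) b = {1/2..1}"
      using b image_mult_atLeastAtMost[of "1 / b" "b / 2" b] by simp
    then have "((\<lambda>y. 1 - F (l * (b * y))) has_integral (1 / b) * integral {b / 2..b} ?h) {1/2..1}"
      using has_integral_affinity[OF I, of b 0] b by simp
    then have "G (l * b) = (1 / b) * integral {b / 2..b} ?h"
      unfolding G_def by (simp add: integral_unique mult.assoc)
    then have I_eq: "integral {b / 2..b} ?h = b * G (l * b)" using b by simp
    have "g (l * b) \<le> G (l * b)"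
      unfolding g_def using r bdd[of "l * b"] by (intro cInf_lower) auto
    also have "\<dots> \<le> b * G (l * b)" using b posG[OF r] by simp
    finally have g_le: "g (l * b) \<le> integral {b / 2..b} ?h" using I_eq by simp
    have ind: "integrable lebesgue (indicat_real {\<mu>..b})"
      using b by (intro integrable_real_indicator) auto
    \<comment> \<open>The majorant is 1 on the left part of the interval and
      \<open>F (l * x)\<close> itself on \<open>[b/2, b]\<close>.\<close>
    have "set_lebesgue_integral lebesgue {\<mu>..b} (\<lambda>x. F (l * x)) \<le>
      (\<integral>x. indicator {\<mu>..b} x - indicator {b / 2..b} x *\<^sub>R ?h x \<partial>lebesgue)"
      unfolding set_lebesgue_integral_def
    proof (rule integral_mono')
      show "integrable lebesgue (\<lambda>x. indicator {\<mu>..b} x - indicator {b / 2..b} x *\<^sub>R ?h x)"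
        using si ind unfolding set_integrable_def
        by (intro Bochner_Integration.integrable_diff) auto
    next
      fix x :: real
      have "F (l * x) \<in> {0..1}" if "x \<ge> \<mu>" using range[of "l * x"] that l \<mu> by auto
      then show "indicator {\<mu>..b} x *\<^sub>R F (l * x) \<le> indicator {\<mu>..b} x - indicator {b / 2..b} x *\<^sub>R ?h x"
        "0 \<le> indicator {\<mu>..b} x - indicator {b / 2..b} x *\<^sub>R ?h x"
        using b by (auto simp: indicator_def)
    qed
    also have "\<dots> = 1 - integral {b / 2..b} ?h"
      using si ind set_lebesgue_integral_eq_integral(2)[OF si] b \<mu>
      unfolding set_integrable_def set_lebesgue_integral_def
      by (subst Bochner_Integration.integral_diff) (auto simp: b_def)
    finally show ?thesis using g_le unfolding b_def by simp
  qed
  ultimately show ?thesis using r0 by (intro exI[of _ g] exI[of _ "r0 / 2"]) auto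
qed

section \<open>Consequences of the law of the iterated logarithm\<close>

text \<open>Because 3 exceeds e. Hence the iterated logarithm is positive for arguments in (0,
  1/3].\<close>

lemma abs_ln_gt_one:
  fixes x :: real
  assumes "0 < x" "x \<le> 1 / 3"
  shows "\<bar>ln x\<bar> > 1"
proof -
  have "exp 1 < (3 :: real)" using e_less_272 by simp
  then have "1 < ln (3 :: real)" by (metis exp_ln exp_less_cancel_iff zero_less_numeral)
  moreover have "ln x \<le> ln (1 / 3)" using assms by simp
  ultimately show ?thesis by (simp add: ln_div)
qed

lemma lil_scale_pos:
  assumes "0 < \<beta>" "0 < \<gamma> x" "0 < x" "x \<le> 1 / 3"
  shows "0 < lil_scale \<beta> \<gamma> x"
  using assms abs_ln_gt_one[of x] by (simp add: lil_scale_def)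

text \<open>The power factors have a constant ratio, and the iterated logarithm varies so slowly
  that halving its argument does not affect the limit.\<close>

lemma tendsto_lil_scale_ratio:
  assumes "\<beta> > 0" and \<gamma>: "\<And>x. x \<in> {0<..1} \<Longrightarrow> \<gamma> x = x powr \<alpha>"
  shows "((\<lambda>r. lil_scale \<beta> \<gamma> (r / 2) / lil_scale \<beta> \<gamma> r) \<longlongrightarrow> (1 / 2) powr (\<alpha> / 2)) (at_right 0)"
proof -
  have "((\<lambda>r::real. \<bar>ln \<bar>ln (r / 2)\<bar>\<bar> / \<bar>ln \<bar>ln r\<bar>\<bar>) \<longlongrightarrow> 1) (at_right 0)"
    by real_asymp
  then have "((\<lambda>r::real. (1 / 2) powr (\<alpha> / 2) * sqrt (\<bar>ln \<bar>ln (r / 2)\<bar>\<bar> / \<bar>ln \<bar>ln r\<bar>\<bar>)) \<longlongrightarrow>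
      (1 / 2) powr (\<alpha> / 2) * sqrt 1) (at_right 0)"
    by (intro tendsto_intros)
  moreover have "eventually (\<lambda>r. (1 / 2) powr (\<alpha> / 2) * sqrt (\<bar>ln \<bar>ln (r / 2)\<bar>\<bar> / \<bar>ln \<bar>ln r\<bar>\<bar>) =
      lil_scale \<beta> \<gamma> (r / 2) / lil_scale \<beta> \<gamma> r) (at_right 0)"
    using eventually_at_right_real[of 0 "1/3", simplified]
  proof eventually_elim
    case (elim r)
    have "(r / 2) powr \<alpha> = r powr \<alpha> * ((1 / 2) powr (\<alpha> / 2))\<^sup>2"
      using elim by (simp add: powr_divide powr_power power_divide)
    then show ?case
      using elim \<open>\<beta> > 0\<close> by (simp add: lil_scale_def \<gamma> real_sqrt_mult real_sqrt_divide)
  qed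
  ultimately show ?thesis by (simp add: tendsto_cong)
qed

section \<open>Limit points of the rescaled paths in C([0,1])\<close>

lemma limitin_C01_pointwise:
  assumes "limitin (mtopology_of C01) \<xi> \<phi> sequentially" "x \<in> {0..1}"
  shows "(\<lambda>n. \<xi> n x) \<longlonglongrightarrow> \<phi> x"
proof -
  interpret Metric_space "mspace C01" "mdist C01"
    by (rule Metric_space_mspace_mdist)
  have \<phi>: "\<phi> \<in> mspace C01"
    and conv: "\<And>\<epsilon>. \<epsilon> > 0 \<Longrightarrow> \<exists>N. \<forall>n\<ge>N. \<xi> n \<in> mspace C01 \<and> mdist C01 (\<xi> n) \<phi> < \<epsilon>"
    using assms(1) unfolding mtopology_of_def limit_metric_sequentially by auto
  show ?thesis
  proof (rule LIMSEQ_I)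
    fix \<epsilon> :: real assume "\<epsilon> > 0"
    then obtain N where N: "\<forall>n\<ge>N. \<xi> n \<in> mspace C01 \<and> mdist C01 (\<xi> n) \<phi> < \<epsilon>"
      using conv by blast
    have "norm (\<xi> n x - \<phi> x) < \<epsilon>" if "n \<ge> N" for n
    proof -
      have "mdist euclidean_metric (\<xi> n x) (\<phi> x) \<le> mdist C01 (\<xi> n) \<phi>"
        using N that \<phi> assms(2) mdist_cfunspace_imp_mdist_le[OF _ _ order_refl, of "\<xi> n" "top_of_set {0..1}" euclidean_metric \<phi> x]
        unfolding C01_def by (simp del: mspace_cfunspace)
      then show ?thesis using N that by (force simp: dist_norm)
    qed
    then show "\<exists>N. \<forall>n\<ge>N. norm (\<xi> n x - \<phi> x) < \<epsilon>" by blast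
  qed
qed

lemma relatively_compact_in_subseq:
  assumes "relatively_compact_in m A" "\<And>n. \<xi> n \<in> A"
  obtains \<phi> and \<sigma> :: "nat \<Rightarrow> nat"
    where "strict_mono \<sigma>" "limitin (mtopology_of m) (\<xi> \<circ> \<sigma>) \<phi> sequentially"
proof -
  interpret Metric_space "mspace m" "mdist m"
    by (rule Metric_space_mspace_mdist)
  have "A \<subseteq> mtopology_of m closure_of A"
    using assms(1) unfolding relatively_compact_in_def by (intro closure_of_subset) auto
  then have "range \<xi> \<subseteq> mtopology_of m closure_of A" using assms(2) by auto
  then show thesis
    using assms(1) that unfolding relatively_compact_in_def mtopology_of_def compactin_sequentially
    by meson
qed

text \<open>Write \<open>u\<close> for \<Gamma>(1,.) and \<open>v\<close> for \<Gamma>(1/2,.)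
  divided by \<open>h\<close>, both unit vectors. A limit point attaining both bounds pairs with
  \<open>u + v\<close> to at least 2, which forces the inner product of \<open>u\<close> and
  \<open>v\<close> to be 1 and the kernel matrix at 1 and 1/2 to be singular.\<close>

lemma (in unit_interval_kernel) eventually_below_lil_scale:
  assumes "\<beta> > 0"
    and \<gamma>: "\<And>x. x \<in> {0<..1} \<Longrightarrow> \<Gamma> x x = x powr \<alpha>"
    and nondegenerate: "nondegenerate_kernel {0<..1} \<Gamma>"
    and rc: "relatively_compact_in C01 (lil_rescaled \<beta> (\<lambda>x. \<Gamma> x x) s ` {0<..1/3})"
    and limits: "limit_points_at_0 C01 {0<..1/3} (lil_rescaled \<beta> (\<lambda>x. \<Gamma> x x) s) \<subseteq> rkhs_unit_ball \<Gamma>"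
  shows "\<exists>r\<^sub>0\<in>{0<..1/3}. \<forall>r\<in>{0<..r\<^sub>0}.
    s r < lil_scale \<beta> (\<lambda>x. \<Gamma> x x) r \<or> s (r / 2) < lil_scale \<beta> (\<lambda>x. \<Gamma> x x) (r / 2)"
proof (rule ccontr)
  let ?\<kappa> = "lil_scale \<beta> (\<lambda>x. \<Gamma> x x)" and ?\<xi> = "lil_rescaled \<beta> (\<lambda>x. \<Gamma> x x) s"
  assume contra: "\<not> ?thesis"
  \<comment> \<open>The radii \<open>1 / (3 + real n)\<close> stay in (0, 1/3] and tend to
    0.\<close>
  have "\<exists>r\<in>{0<..1 / (3 + real n)}. ?\<kappa> r \<le> s r \<and> ?\<kappa> (r / 2) \<le> s (r / 2)" for n
  proof -
    have "1 / (3 + real n) \<in> {0<..1/3}" by (auto simp: field_simps)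
    then show ?thesis using contra by (meson not_less)
  qed
  then obtain \<rho> where \<rho>: "\<And>n. \<rho> n \<in> {0<..1 / (3 + real n)}"
    and above: "\<And>n. ?\<kappa> (\<rho> n) \<le> s (\<rho> n)" "\<And>n. ?\<kappa> (\<rho> n / 2) \<le> s (\<rho> n / 2)"
    by metis
  have \<rho>_pos: "\<rho> n > 0" for n using \<rho>[of n] by simp
  have \<rho>_le: "\<rho> n \<le> 1 / 3" for n
  proof -
    have "\<rho> n \<le> 1 / (3 + real n)" using \<rho>[of n] by simp
    also have "\<dots> \<le> 1 / 3" by (simp add: field_simps)
    finally show ?thesis .
  qed
  have "(\<lambda>n. 1 / (3 + real n)) \<longlonglongrightarrow> 0" by real_asymp
  then have \<rho>_lim: "\<rho> \<longlonglongrightarrow> 0"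
    by (rule Lim_null_comparison[rotated]) (use \<rho> in \<open>auto intro!: always_eventually simp: less_imp_le\<close>)
  have "?\<xi> (\<rho> n) \<in> ?\<xi> ` {0<..1/3}" for n using \<rho>_pos[of n] \<rho>_le[of n] by simp
  then obtain \<phi> \<sigma> where \<sigma>: "strict_mono \<sigma>"
    and \<phi>: "limitin (mtopology_of C01) ((\<lambda>n. ?\<xi> (\<rho> n)) \<circ> \<sigma>) \<phi> sequentially"
    by (rule relatively_compact_in_subseq[OF rc, of "\<lambda>n. ?\<xi> (\<rho> n)"])
  have lim: "(\<rho> \<circ> \<sigma>) \<longlonglongrightarrow> 0"
    using \<rho>_lim \<sigma> by (rule LIMSEQ_subseq_LIMSEQ)
  have "range (\<rho> \<circ> \<sigma>) \<subseteq> {0<..1/3}" using \<rho>_pos \<rho>_le by auto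
  with lim \<phi> have "\<phi> \<in> limit_points_at_0 C01 {0<..1/3} ?\<xi>"
    unfolding limit_points_at_0_def by (auto intro!: exI[of _ "\<rho> \<circ> \<sigma>"] simp: o_def)
  then have ball: "\<phi> \<in> rkhs_unit_ball \<Gamma>" using limits by auto
  have pointwise: "(\<lambda>n. ?\<xi> (\<rho> (\<sigma> n)) x) \<longlonglongrightarrow> \<phi> x" if "x \<in> {0..1}" for x
    using limitin_C01_pointwise[OF \<phi> that] by (simp add: o_def)
  have \<kappa>_pos: "?\<kappa> (\<rho> n) > 0" for n
    using \<rho>_pos[of n] \<rho>_le[of n] \<open>\<beta> > 0\<close> by (intro lil_scale_pos) (auto simp: \<gamma>)
  have "1 \<le> \<phi> 1"
  proof (rule LIMSEQ_le_const[OF pointwise])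
    show "\<exists>N. \<forall>n\<ge>N. 1 \<le> ?\<xi> (\<rho> (\<sigma> n)) 1"
      using above(1) \<kappa>_pos by (auto simp: lil_rescaled_def)
  qed simp
  \<comment> \<open>Both the limit of \<open>?\<kappa> (r / 2) / ?\<kappa> r\<close> and the square
    root of \<Gamma>(1/2,1/2).\<close>
  define h where "h = (1 / 2 :: real) powr (\<alpha> / 2)"
  have h: "h > 0" "h\<^sup>2 = \<Gamma> (1/2) (1/2)"
    by (simp_all add: h_def \<gamma> power2_eq_square powr_add[symmetric])
  have "h \<le> \<phi> (1/2)"
  proof (rule LIMSEQ_le[OF _ pointwise])
    have "filterlim (\<rho> \<circ> \<sigma>) (at_right 0) sequentially"
      using lim \<rho>_pos by (intro tendsto_imp_filterlim_at_right) auto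
    from filterlim_compose[OF tendsto_lil_scale_ratio[OF \<open>\<beta> > 0\<close> \<gamma>] this]
    show "(\<lambda>n. ?\<kappa> (\<rho> (\<sigma> n) / 2) / ?\<kappa> (\<rho> (\<sigma> n))) \<longlonglongrightarrow> h"
      by (simp add: h_def o_def)
    \<comment> \<open>The rescaled path at 1/2 is \<open>s\<close> at half the radius, still divided
      by the scale at the full radius.\<close>
    show "\<exists>N. \<forall>n\<ge>N. ?\<kappa> (\<rho> (\<sigma> n) / 2) / ?\<kappa> (\<rho> (\<sigma> n)) \<le> ?\<xi> (\<rho> (\<sigma> n)) (1/2)"
      using divide_right_mono[OF above(2) less_imp_le[OF \<kappa>_pos]] by (auto simp: lil_rescaled_def)
  qed simp
  then have "1 \<le> \<phi> (1/2) / h"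
    using h by simp
  with \<open>1 \<le> \<phi> 1\<close> have "2 \<le> \<phi> 1 + \<phi> (1/2) / h"
    by linarith
  \<comment> \<open>Weights 1 and \<open>1 / h\<close> normalise both kernel functions, so the right
    side becomes the squared norm of \<open>u + v\<close>.\<close>
  then have "4 \<le> (1 * \<phi> 1 + 1 / h * \<phi> (1/2))\<^sup>2"
    using power_mono[of 2 "\<phi> 1 + \<phi> (1/2) / h" 2] by simp
  also have "\<dots> \<le> 1\<^sup>2 * \<Gamma> 1 1 + 2 * 1 * (1 / h) * \<Gamma> 1 (1/2) + (1 / h)\<^sup>2 * \<Gamma> (1/2) (1/2)"
    by (rule rkhs_unit_ball_two_point[OF ball]) auto
  also have "\<dots> = 2 + 2 * (\<Gamma> 1 (1/2) / h)"
    using h by (simp add: \<gamma>[of 1] power_divide h(2)[symmetric])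
  finally have "h \<le> \<Gamma> 1 (1/2)" using h by (simp add: field_simps)
  \<comment> \<open>The opposite bound comes from the squared norm of \<open>u - v\<close> being
    nonnegative.\<close>
  moreover have "\<Gamma> 1 (1/2) \<le> h"
  proof -
    let ?a = "\<lambda>x::real. if x = 1 then 1 else - 1 / h"
    have "0 \<le> (\<Sum>x\<in>{1, 1/2}. \<Sum>y\<in>{1, 1/2}. ?a x * ?a y * \<Gamma> x y)"
      by (intro psd) auto
    also have "\<dots> = 2 - 2 * (\<Gamma> 1 (1/2) / h)"
      using h sym[of 1 "1/2"] by (simp add: \<gamma>[of 1] h(2)[symmetric] power2_eq_square)
    finally show ?thesis using h by (simp add: field_simps)
  qed
  ultimately have "\<Gamma> 1 1 * \<Gamma> (1/2) (1/2) = \<Gamma> 1 (1/2) * \<Gamma> (1/2) 1"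
    using h sym[of 1 "1/2"] by (simp add: \<gamma>[of 1] power2_eq_square)
  then show False
    using nondegenerate_kernel_two_points[OF nondegenerate, of 1 "1/2"] by simp
qed

text \<open>Strictly between 0 and 1 the inner logarithm is nonzero, so the outer one is continuous
  there.\<close>

lemma continuous_on_lil_scale:
  assumes "\<And>x. x \<in> {0<..<1} \<Longrightarrow> \<gamma> x = x powr \<alpha>"
  shows "continuous_on {0<..<1} (lil_scale \<beta> \<gamma>)"
proof -
  have "continuous_on {0<..<1} (\<lambda>x. \<beta> * sqrt (x powr \<alpha> * \<bar>ln \<bar>ln x\<bar>\<bar>))"
    by (intro continuous_intros) auto
  then show ?thesis
    by (rule continuous_on_cong[THEN iffD1, rotated -1]) (auto simp: lil_scale_def assms)
qed


theorem proposition3p1: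
  fixes M :: "'w measure"
    and S :: "real \<Rightarrow> 'w \<Rightarrow> real"
    and \<Gamma> :: "real \<Rightarrow> real \<Rightarrow> real"
    and \<gamma> \<kappa> :: "real \<Rightarrow> real"
    and \<alpha>\<^sub>2 \<beta> :: real
    and f\<^sub>0 f :: "'w \<Rightarrow> real \<Rightarrow> real"
  assumes "prob_space M"
    and gaussian: "gaussian_process M {0..1} S"
    and centered: "\<forall>x\<in>{0..1}. (\<integral>\<omega>. S x \<omega> \<partial>M) = 0"
    and continuous: "AE \<omega> in M. continuous_on {0..1} (\<lambda>x. S x \<omega>)"
    and S_0: "AE \<omega> in M. S 0 \<omega> = 0"
    and S_1: "(\<integral>\<omega>. (S 1 \<omega>)\<^sup>2 \<partial>M) = 1"
    and covariance: "\<forall>x\<in>{0..1}. \<forall>y\<in>{0..1}. \<Gamma> x y = (\<integral>\<omega>. S x \<omega> * S y \<omega> \<partial>M)"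
    and cov_continuous: "continuous_on ({0..1} \<times> {0..1}) (\<lambda>(x, y). \<Gamma> x y)"
    and nondegenerate: "nondegenerate_kernel {0<..1} \<Gamma>"
    and "\<alpha>\<^sub>2 > 0"
    and self_similar: "\<forall>r\<in>{0<..1}.
      equal_in_law M {0..1} (\<lambda>x \<omega>. S (r * x) \<omega>) (\<lambda>x \<omega>. r powr (\<alpha>\<^sub>2 / 2) * S x \<omega>)"
    and LIL: "local_functional_LIL M S \<Gamma> \<beta>"
    and gamma: "\<forall>x\<in>{0..1}. \<gamma> x = \<Gamma> x x"
    and kappa: "\<forall>x\<in>{0..1}. \<kappa> x = lil_scale \<beta> \<gamma> x"
    and f0_random: "\<forall>x>1. (\<lambda>\<omega>. f\<^sub>0 \<omega> x) \<in> borel_measurable M"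
    and f0_range: "\<forall>\<omega>\<in>space M. \<forall>x>1. f\<^sub>0 \<omega> x \<in> {0..1}"
    and f: "\<forall>\<omega>\<in>space M. \<forall>x\<ge>0. f \<omega> x =
      (if x \<le> 1 then min (max (1 + S x \<omega> - \<kappa> x) 0) 1 else f\<^sub>0 \<omega> x)"
    and f_integral: "AE \<omega> in M. set_integrable lebesgue {0..} (f \<omega>) \<and>
      set_lebesgue_integral lebesgue {0..} (f \<omega>) = 1"
    and f_moment: "AE \<omega> in M. set_integrable lebesgue {0..} (\<lambda>x. x * f \<omega> x)"
  shows "AE \<omega> in M.
    (\<forall>x\<ge>0. f \<omega> x \<le> 1) \<and>
    set_integrable lebesgue {0..} (\<lambda>x. x * f \<omega> x) \<and>
    (\<exists>g :: real \<Rightarrow> real. \<exists>l\<^sub>0>0.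
      (\<forall>x>0. g x > 0) \<and> mono_on {0<..} g \<and>
      (\<forall>l\<in>{0<..<l\<^sub>0}. \<forall>\<mu>\<in>{0..1}.
        set_lebesgue_integral lebesgue {\<mu>..\<mu> + 1} (\<lambda>x. f \<omega> (l * x)) \<le> 1 - g (l * (\<mu> + 1))))"
proof -
  interpret prob_space M by fact
  have rv: "gaussian_rv M (S x)" if "x \<in> {0..1}" for x
    using gaussian_process_rv[OF gaussian that] .
  have meas: "S x \<in> borel_measurable M" if "x \<in> {0..1}" for x
    using rv[OF that] by (simp add: gaussian_rv_def)
  have "psd_kernel {0..1} \<Gamma>"
    using covariance by (intro covariance_psd_kernel[OF meas] gaussian_rv_integrable_square rv)
      (auto intro: prob_space_axioms)
  then interpret unit_interval_kernel \<Gamma>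
    by (simp add: unit_interval_kernel_def)
  \<comment> \<open>Self-similarity at time 1, where the variance is 1.\<close>
  have \<Gamma>_diag: "\<Gamma> x x = x powr \<alpha>\<^sub>2" if "x \<in> {0<..1}" for x
    using self_similar_second_moment[OF self_similar[rule_format, OF that] that meas] that S_1
    by (simp add: covariance power2_eq_square)
  have "\<beta> > 0" using LIL by (simp add: local_functional_LIL_def)
  have "AE \<omega> in M. relatively_compact_in C01 (lil_rescaled \<beta> (\<lambda>x. \<Gamma> x x) (\<lambda>x. S x \<omega>) ` {0<..1/3}) \<and>
      limit_points_at_0 C01 {0<..1/3} (lil_rescaled \<beta> (\<lambda>x. \<Gamma> x x) (\<lambda>x. S x \<omega>)) = rkhs_unit_ball \<Gamma>"
    using LIL by (simp add: local_functional_LIL_def Let_def)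
  \<comment> \<open>From here a single path is fixed; the remaining argument is
    deterministic.\<close>
  then show ?thesis
    using f_moment continuous AE_space
  proof eventually_elim
    case (elim \<omega>)
    have range: "f \<omega> x \<in> {0..1}" if "x \<ge> 0" for x
      using f f0_range elim that by auto
    have \<kappa>_eq: "\<kappa> x = lil_scale \<beta> (\<lambda>x. \<Gamma> x x) x" if "x \<in> {0..1}" for x
      using kappa gamma that by (simp add: lil_scale_def)
    have f_eq: "f \<omega> x = min (max (1 + S x \<omega> - lil_scale \<beta> (\<lambda>x. \<Gamma> x x) x) 0) 1"
      if "x \<in> {0..1}" for x
      using f elim that by (simp add: \<kappa>_eq)
    obtain r\<^sub>0 where r\<^sub>0: "r\<^sub>0 \<in> {0<..1/3}"
      and gap: "\<And>r. r \<in> {0<..r\<^sub>0} \<Longrightarrow> S r \<omega> < lil_scale \<beta> (\<lambda>x. \<Gamma> x x) r \<or>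
        S (r / 2) \<omega> < lil_scale \<beta> (\<lambda>x. \<Gamma> x x) (r / 2)"
      using eventually_below_lil_scale[OF \<open>\<beta> > 0\<close> \<Gamma>_diag nondegenerate, of "\<lambda>x. S x \<omega>"] elim
      by auto
    have "continuous_on {0<..<1} (lil_scale \<beta> (\<lambda>x. \<Gamma> x x))"
      by (rule continuous_on_lil_scale) (simp add: \<Gamma>_diag)
    then have "continuous_on {0<..r\<^sub>0} (lil_scale \<beta> (\<lambda>x. \<Gamma> x x))"
      by (rule continuous_on_subset) (use r\<^sub>0 in auto)
    moreover have "continuous_on {0<..r\<^sub>0} (\<lambda>x. S x \<omega>)"
      using elim(3) by (rule continuous_on_subset) (use r\<^sub>0 in auto)
    ultimately have "continuous_on {0<..r\<^sub>0} (\<lambda>x. min (max (1 + S x \<omega> - lil_scale \<beta> (\<lambda>x. \<Gamma> x x) x) 0) 1)"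
      by (intro continuous_intros)
    \<comment> \<open>As \<open>r\<^sub>0\<close> is at most 1/3, only the branch of
      \<open>f\<close> on [0,1] enters, away from the conventional values of the scale at 0 and
      1.\<close>
    then have cont: "continuous_on {0<..r\<^sub>0} (f \<omega>)"
      by (rule continuous_on_cong[THEN iffD1, rotated -1]) (use r\<^sub>0 in \<open>auto simp: f_eq\<close>)
    \<comment> \<open>On [0,1] the truncated expression is below 1 exactly where the path is below
      the scale.\<close>
    have "f \<omega> r < 1 \<or> f \<omega> (r / 2) < 1" if "r \<in> {0<..r\<^sub>0}" for r
      using gap[OF that] that r\<^sub>0 by (auto simp: f_eq min_less_iff_disj)
    from continuous_gap_lower_bound[OF _ cont range this] r\<^sub>0 elim range
    show ?case by auto
  qed
qed

end
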